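(* Let $k\ge1$ be an integer, $r$ any integer and $m$ an even integer. Then \begin{align*} &\sum_{n=1}^\infty\frac{\lfloor n/k\rfloor}{L_m^{n+1}}\Big(\frac{L_{mn+r}L_m}{n}-\frac{L_{m(n+1)+r}}{n+1}\Big)\\ &\quad=-\frac{\beta^r}{k}\log\big(L_m^{2k}-L_m^kL_{mk}+1\big)-\frac{\sqrt5}{k}F_r\log\big(L_m^k-\alpha^{mk}\big)+L_r\log L_m, \end{align*} and \begin{align*} &\sum_{n=1}^\infty\frac{\lfloor n/k\rfloor}{L_m^{n+1}}\Big(\frac{F_{mn+r}L_m}{n}-\frac{F_{m(n+1)+r}}{n+1}\Big)\\ &\quad=\frac{\beta^r}{\sqrt5\,k}\log\big(L_m^{2k}-L_m^kL_{mk}+1\big)-\frac{L_r}{\sqrt5\,k}\log\big(L_m^k-\alpha^{mk}\big)+F_r\log L_m. \end{align*}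
   Context: $\alpha=(1+\sqrt5)/2$, $\beta=(1-\sqrt5)/2$; $F_n=(\alpha^n-\beta^n)/\sqrt5$ and $L_n=\alpha^n+\beta^n$ are the Fibonacci and Lucas numbers for all integers $n$. $\lfloor x\rfloor$ is the floor function and $\log$ the natural logarithm. *)

theory Defs
  imports Complex_Main
begin

definition gr_alpha :: real where
  "gr_alpha = (1 + sqrt 5) / 2"

definition gr_beta :: real where
  "gr_beta = (1 - sqrt 5) / 2"

text \<open>
  Fibonacci and Lucas numbers at arbitrary integer indices, given by the Binet formulas and
  hence real-valued; the exponent in \<^term>\<open>x powi n\<close> is an integer.
\<close>

definition fibonacci :: "int \<Rightarrow> real" where
  "fibonacci n = (gr_alpha powi n - gr_beta powi n) / sqrt 5"

definition lucas :: "int \<Rightarrow> real" where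
  "lucas n = gr_alpha powi n + gr_beta powi n"

end

theory Submission
  imports Defs "HOL-Analysis.Complex_Transcendental"
begin

text \<open>
  Put \<open>x = \<alpha>\<^sup>m / L\<^sub>m\<close> and \<open>y = \<beta>\<^sup>m / L\<^sub>m\<close>. As \<open>m\<close> is even, both lie strictly between 0 and 1,
  and by Binet's formulas the two series are combinations, with coefficients \<open>\<alpha>\<^sup>r\<close> and
  \<open>\<beta>\<^sup>r\<close> (respectively \<open>\<alpha>\<^sup>r/\<surd>5\<close> and \<open>-\<beta>\<^sup>r/\<surd>5\<close>), of the series of \<open>\<lfloor>n/k\<rfloor> (z\<^sup>n/n - z\<^sup>n\<^sup>+\<^sup>1/(n+1))\<close> for \<open>z = x\<close> and \<open>z = y\<close>.
  Summation by parts retains only the indices where \<open>\<lfloor>n/k\<rfloor>\<close> jumps, that is, the multiples of \<open>k\<close>,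
  so the latter series equals \<open>- ln (1 - z\<^sup>k) / k\<close>. Finally \<open>\<alpha>\<^sup>m \<beta>\<^sup>m = 1\<close> gives the factorisation
  \<open>L\<^sub>m\<^sup>2\<^sup>k - L\<^sub>m\<^sup>k L\<^sub>m\<^sub>k + 1 = (L\<^sub>m\<^sup>k - \<alpha>\<^sup>m\<^sup>k) (L\<^sub>m\<^sup>k - \<beta>\<^sup>m\<^sup>k)\<close>.
\<close>

text \<open>Abel summation: \<open>Suc N div k\<close> exceeds \<open>N div k\<close> by one exactly
  at multiples of \<open>k\<close>. The right-hand sum also meets the index 0, hence
  \<open>a 0 = 0\<close>.\<close>

lemma sum_div_mult_diff:
  fixes a :: "nat \<Rightarrow> real"
  assumes "a 0 = 0"
  shows "(\<Sum>i<N. real (Suc i div k) * (a (Suc i) - a (Suc (Suc i))))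
       = (\<Sum>n<Suc N. if k dvd n then a n else 0) - real (N div k) * a (Suc N)"
proof (induction N)
  case 0
  then show ?case using assms by simp
next
  case (Suc N)
  have "Suc N div k = (if k dvd Suc N then Suc (N div k) else N div k)"
    by (simp add: div_Suc dvd_eq_mod_eq_0)
  with Suc show ?case
    by (auto simp: algebra_simps)
qed

lemma sums_div_mult_diff_power:
  fixes x :: real
  assumes "\<bar>x\<bar> < 1" and "k \<ge> 1"
  shows "(\<lambda>i. real (Suc i div k)
           * (x ^ Suc i / real (Suc i) - x ^ Suc (Suc i) / real (Suc (Suc i))))
         sums (- ln (1 - x ^ k) / real k)"
proof -
  \<comment> \<open>Division by zero makes \<open>a 0 = 0\<close>, as
    \<open>sum_div_mult_diff\<close> requires.\<close>
  define a where "a = (\<lambda>n. x ^ n / real n)"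
  have "\<bar>- (x ^ k)\<bar> < 1"
    using assms by (simp add: power_abs power_less_one_iff)
  from sums_minus[OF ln_series'[OF this]]
  have "(\<lambda>n. (x ^ k) ^ n / real n) sums (- ln (1 - x ^ k))"
    by simp
  from sums_divide[OF this, of "real k"]
  have "(\<lambda>n. if k dvd n * k then a (n * k) else 0) sums (- ln (1 - x ^ k) / real k)"
    by (simp add: a_def mult.commute flip: power_mult)
  moreover have "strict_mono (\<lambda>n. n * k)"
    using assms by (simp add: strict_mono_def)
  ultimately have "(\<lambda>n. if k dvd n then a n else 0) sums (- ln (1 - x ^ k) / real k)"
    by (subst (asm) sums_mono_reindex) (auto simp: image_iff dvd_def mult.commute)
  then have lim: "(\<lambda>N. \<Sum>n<Suc N. if k dvd n then a n else 0)
      \<longlonglongrightarrow> - ln (1 - x ^ k) / real k"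
    unfolding sums_def by (rule LIMSEQ_Suc)
  \<comment> \<open>The boundary term vanishes: the denominator of \<open>a (Suc N)\<close> absorbs
    \<open>N div k\<close>, leaving a geometric bound.\<close>
  have "norm (real (N div k) * a (Suc N)) \<le> \<bar>x\<bar> ^ Suc N" for N
  proof -
    have "real (N div k) \<le> real (Suc N)"
      by (meson div_le_dividend le_SucI of_nat_mono)
    then have "real (N div k) * \<bar>x\<bar> ^ Suc N \<le> real (Suc N) * \<bar>x\<bar> ^ Suc N"
      by (rule mult_right_mono) simp
    then show ?thesis
      by (simp add: a_def abs_mult power_abs field_simps del: power_Suc of_nat_Suc)
  qed
  moreover have "(\<lambda>N. \<bar>x\<bar> ^ Suc N) \<longlonglongrightarrow> 0"
    using assms by (intro LIMSEQ_Suc LIMSEQ_power_zero) simp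
  ultimately have "(\<lambda>N. real (N div k) * a (Suc N)) \<longlonglongrightarrow> 0"
    by (rule Lim_null_comparison[OF always_eventually[OF allI]])
  from tendsto_diff[OF lim this]
  have "(\<lambda>i. real (Suc i div k) * (a (Suc i) - a (Suc (Suc i))))
      sums (- ln (1 - x ^ k) / real k)"
    unfolding sums_def by (subst sum_div_mult_diff) (simp_all add: a_def)
  then show ?thesis
    by (simp only: a_def)
qed

theorem theorem8:
  fixes k :: nat and r m :: int
  assumes "k \<ge> 1" and "even m"
  shows
    "(\<lambda>i. let n = Suc i in
        real_of_int \<lfloor>real n / real k\<rfloor> / lucas m ^ (n + 1) *
        (lucas (m * int n + r) * lucas m / real n
          - lucas (m * (int n + 1) + r) / (real n + 1)))
     sums
       (- (gr_beta powi r / real k)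
            * ln (lucas m ^ (2 * k) - lucas m ^ k * lucas (m * int k) + 1)
        - sqrt 5 / real k * fibonacci r * ln (lucas m ^ k - gr_alpha powi (m * int k))
        + lucas r * ln (lucas m))
     \<and>
     (\<lambda>i. let n = Suc i in
        real_of_int \<lfloor>real n / real k\<rfloor> / lucas m ^ (n + 1) *
        (fibonacci (m * int n + r) * lucas m / real n
          - fibonacci (m * (int n + 1) + r) / (real n + 1)))
     sums
       (gr_beta powi r / (sqrt 5 * real k)
            * ln (lucas m ^ (2 * k) - lucas m ^ k * lucas (m * int k) + 1)
        - lucas r / (sqrt 5 * real k) * ln (lucas m ^ k - gr_alpha powi (m * int k))
        + fibonacci r * ln (lucas m))"
proof -
  define p q L A B where "p = gr_alpha powi m" and "q = gr_beta powi m" and "L = lucas m"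
    and "A = L ^ k - p ^ k" and "B = L ^ k - q ^ k"
  define S where "S = (\<lambda>z i. real (Suc i div k)
    * ((z / L) ^ Suc i / real (Suc i) - (z / L) ^ Suc (Suc i) / real (Suc (Suc i))))"
  have nz: "gr_alpha \<noteq> 0" "gr_beta \<noteq> 0"
    by (simp_all add: gr_alpha_def gr_beta_def add_nonneg_eq_0_iff)
  have "gr_alpha * gr_beta = - 1"
    by (simp add: gr_alpha_def gr_beta_def field_simps)
  then have pq: "p * q = 1"
    using \<open>even m\<close> by (simp add: p_def q_def flip: power_int_mult_distrib)
  \<comment> \<open>Both \<open>p\<close> and \<open>q\<close> are squares of nonzero reals, hence
    positive.\<close>
  obtain j where "m = j * 2"
    using \<open>even m\<close> by (metis evenE mult.commute)
  then have pos: "p > 0" "q > 0"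
    using nz by (simp_all add: p_def q_def power_int_mult)
  have L: "L = p + q"
    by (simp add: L_def p_def q_def lucas_def)
  have pow: "gr_alpha powi (m * int n + s) = p ^ n * gr_alpha powi s"
    "gr_beta powi (m * int n + s) = q ^ n * gr_beta powi s" for n s
    using nz by (simp_all add: p_def q_def power_int_add power_int_mult)
  have AB: "A > 0" "B > 0"
    using pos \<open>k \<ge> 1\<close> by (simp_all add: A_def B_def L power_strict_mono)
  have prod: "L ^ (2 * k) - L ^ k * lucas (m * int k) + 1 = A * B"
  proof -
    have "p ^ k * q ^ k = 1"
      using pq by (simp flip: power_mult_distrib)
    then show ?thesis
      using pow[of k 0] by (simp add: A_def B_def lucas_def power_even_eq)
        (simp add: power2_eq_square algebra_simps)
  qed
  have sum_S: "S z sums (ln L - ln (L ^ k - z ^ k) / real k)" if "z = p \<or> z = q" for z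
  proof -
    have z: "0 < z" "z < L" "0 < L ^ k - z ^ k"
      using that pos AB by (auto simp: L A_def B_def)
    have "1 - (z / L) ^ k = (L ^ k - z ^ k) / L ^ k"
      using z by (simp add: field_simps)
    \<comment> \<open>Splitting off \<open>L ^ k\<close> produces the \<open>ln L\<close> term of
      the result.\<close>
    then have "ln (1 - (z / L) ^ k) = ln (L ^ k - z ^ k) - real k * ln L"
      using z by (simp add: ln_div ln_realpow)
    then have "- ln (1 - (z / L) ^ k) / real k = ln L - ln (L ^ k - z ^ k) / real k"
      using \<open>k \<ge> 1\<close> by (simp add: field_simps)
    then show ?thesis
      using sums_div_mult_diff_power[of "z / L" k] z \<open>k \<ge> 1\<close> by (simp add: S_def)
  qed
  \<comment> \<open>The factor \<open>L\<close> in the first fraction lowers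
    \<open>L ^ (n + 1)\<close> to \<open>L ^ n\<close>, so both fractions become powers of
    \<open>p / L\<close> and \<open>q / L\<close>.\<close>
  have combine: "real_of_int \<lfloor>real (Suc i) / real k\<rfloor> / L ^ (Suc i + 1)
      * ((c * p ^ Suc i + d * q ^ Suc i) * L / real (Suc i)
        - (c * p ^ Suc (Suc i) + d * q ^ Suc (Suc i)) / (real (Suc i) + 1))
      = c * S p i + d * S q i" for c d i
  proof -
    have "real_of_int \<lfloor>real (Suc i) / real k\<rfloor> = real (Suc i div k)"
      by (simp add: floor_divide_of_nat_eq del: of_nat_Suc)
    moreover have "L \<noteq> 0" using pos L by simp
    ultimately show ?thesis
      by (simp add: S_def power_divide divide_simps del: of_nat_Suc) (simp add: algebra_simps)
  qed
  have main: "(\<lambda>i. real_of_int \<lfloor>real (Suc i) / real k\<rfloor> / L ^ (Suc i + 1)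
      * ((c * p ^ Suc i + d * q ^ Suc i) * L / real (Suc i)
        - (c * p ^ Suc (Suc i) + d * q ^ Suc (Suc i)) / (real (Suc i) + 1)))
      sums (c * (ln L - ln A / real k) + d * (ln L - ln B / real k))" for c d
    unfolding combine A_def B_def by (intro sums_add sums_mult sum_S) auto
  have idx: "m * (int (Suc i) + 1) + r = m * int (Suc (Suc i)) + r" for i
    by simp
  have luc: "lucas (m * int n + r) = gr_alpha powi r * p ^ n + gr_beta powi r * q ^ n" for n
    by (simp add: lucas_def pow)
  have fib: "fibonacci (m * int n + r)
      = gr_alpha powi r / sqrt 5 * p ^ n + (- (gr_beta powi r) / sqrt 5) * q ^ n" for n
    by (simp add: fibonacci_def pow diff_divide_distrib mult.commute)
  have lnAB: "ln (A * B) = ln A + ln B"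
    using AB by (simp add: ln_mult)
  have A: "L ^ k - gr_alpha powi (m * int k) = A"
    using pow[of k 0] by (simp add: A_def)
  have k: "real k \<noteq> 0" using \<open>k \<ge> 1\<close> by simp
  \<comment> \<open>Since \<open>sqrt 5 * fibonacci r\<close> is the difference of the powers of
    \<alpha> and \<beta>, the \<beta> part of the coefficient of \<open>ln A\<close> cancels; in
    \<open>eq2\<close>, \<open>lucas r\<close> does the same.\<close>
  have eq1: "- (gr_beta powi r / real k) * (ln A + ln B)
        - sqrt 5 / real k * fibonacci r * ln A + lucas r * ln L
      = gr_alpha powi r * (ln L - ln A / real k) + gr_beta powi r * (ln L - ln B / real k)"
    using k by (simp add: fibonacci_def lucas_def field_simps)
  have eq2: "gr_beta powi r / (sqrt 5 * real k) * (ln A + ln B)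
        - lucas r / (sqrt 5 * real k) * ln A + fibonacci r * ln L
      = gr_alpha powi r / sqrt 5 * (ln L - ln A / real k)
        + (- (gr_beta powi r) / sqrt 5) * (ln L - ln B / real k)"
    using k by (simp add: fibonacci_def lucas_def field_simps)
  show ?thesis
    unfolding Let_def L_def[symmetric] prod A lnAB idx luc fib eq1 eq2
    by (intro conjI main)
qed

end
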